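(* Consider the Diophantine equation $xy = z^4$ in positive integers $x, y, z$. A triple $(x,y,z)$ of positive integers is a solution of this equation if and only if there exist positive integers $d, t_1, t_2, f, g$ with $\gcd(t_1,t_2)=1$ and $\gcd(f,g)=1$ such that $$x = d^2 t_1^3 t_2 f^4,\qquad y = d^2 t_1 t_2^3 g^4,\qquad z = d\, t_1 t_2 f g .$$ *)

theory Defs
  imports Main "HOL-Computational_Algebra.Primes"
begin

end

theory Submission
  imports Defs "HOL-Computational_Algebra.Squarefree" "HOL-Computational_Algebra.Nth_Powers"
begin

text \<open>
  Write \<open>x = h u\<^sup>2\<close> and \<open>y = h v\<^sup>2\<close> with \<open>h = gcd x y\<close>: the cofactors are squares because they are
  coprime with product a square. Then \<open>h u v = z\<^sup>2\<close>. Splitting off square parts, \<open>u = t\<^sub>1 f\<^sup>2\<close> and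
  \<open>v = t\<^sub>2 g\<^sup>2\<close> with \<open>t\<^sub>1 t\<^sub>2\<close> squarefree, so \<open>h t\<^sub>1 t\<^sub>2\<close> is a square and hence
  \<open>h = t\<^sub>1 t\<^sub>2 d\<^sup>2\<close>.
\<close>

text \<open>With \<open>g = gcd c m\<close>, the cofactor \<open>c'\<close> of \<open>g\<close> in
  \<open>c\<close> is coprime to \<open>m'\<close>, so it divides \<open>g\<close>. Then
  \<open>c' ^ 2\<close> divides \<open>c\<close>, which forces \<open>c' = 1\<close>.\<close>

lemma squarefree_dvd_square_imp_dvd:
  fixes c m :: nat
  assumes "squarefree c" "c dvd m ^ 2"
  shows "c dvd m"
proof -
  define g where "g = gcd c m"
  have "c \<noteq> 0" using assms(1) not_squarefree_0 by metis
  then have "g \<noteq> 0" by (simp add: g_def)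
  then obtain c' m' where c: "c = c' * g" and m: "m = m' * g" and "coprime c' m'"
    using gcd_coprime_exists[of c m, folded g_def] by blast
  from assms(2) have "c' dvd g * m' ^ 2"
    using \<open>g \<noteq> 0\<close> by (auto simp: c m power2_eq_square ac_simps)
  then have "c' dvd g"
    using \<open>coprime c' m'\<close> by (simp add: coprime_dvd_mult_left_iff)
  then have "c' ^ 2 dvd c" by (simp add: c power2_eq_square)
  then have "c' dvd 1" using assms(1) squarefreeD by blast
  then show ?thesis by (simp add: c m)
qed

text \<open>Since \<open>c\<close> divides \<open>m\<close>, one factor \<open>c\<close> cancels
  from \<open>h * c = (c * d) ^ 2\<close>. Used with \<open>c = s * t\<close> to extract
  \<open>d\<close>.\<close>

lemma square_mult_squarefreeE:
  fixes c h m :: nat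
  assumes "squarefree c" "h * c = m ^ 2"
  obtains d where "h = c * d ^ 2"
proof -
  have "c dvd m ^ 2" using assms(2) by (metis dvd_triv_right)
  then obtain d where "m = c * d"
    using squarefree_dvd_square_imp_dvd[OF assms(1)] by blast
  moreover have "c \<noteq> 0" using assms(1) not_squarefree_0 by metis
  ultimately have "h = c * d ^ 2"
    using assms(2) by (simp add: power2_eq_square)
  then show thesis by (rule that)
qed

lemma mult_eq_power4_param:
  fixes x y z :: nat
  assumes "x > 0" "y > 0" "x * y = z ^ 4"
  obtains d s t f g :: nat where "coprime s t" "coprime f g"
    "x = d ^ 2 * s ^ 3 * t * f ^ 4" "y = d ^ 2 * s * t ^ 3 * g ^ 4" "z = d * s * t * f * g"
proof -
  define h where "h = gcd x y"
  have "h > 0" using assms(1) by (simp add: h_def)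
  then obtain x' y' where x': "x = x' * h" and y': "y = y' * h" and "coprime x' y'"
    using gcd_coprime_exists[of x y, folded h_def] by blast
  have "h ^ 2 * (x' * y') = (z ^ 2) ^ 2"
    using assms(3) by (simp add: x' y' power2_eq_square power4_eq_xxxx ac_simps)
  \<comment> \<open>The nonzero square \<open>h ^ 2\<close> cancels from a square and leaves a
    square.\<close>
  then have "is_nth_power 2 (x' * y')"
    using is_nth_power_mult_cancel_left[of 2 "h ^ 2" "x' * y'"] \<open>h > 0\<close>
    by (metis is_nth_powerI not_gr0 power_eq_0_iff)
  then obtain u v where u: "x' = u ^ 2" and v: "y' = v ^ 2"
    using is_nth_power_mult_coprime_nat_iff[OF \<open>coprime x' y'\<close>] by (auto elim!: is_nth_powerE)
  have "coprime u v" using \<open>coprime x' y'\<close> by (simp add: u v)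
  have "(h * u * v) ^ 2 = (z ^ 2) ^ 2"
    using assms(3) by (simp add: x' y' u v power2_eq_square power4_eq_xxxx ac_simps)
  then have huv: "h * u * v = z ^ 2" by (simp only: power2_eq_iff_nonneg zero_le)
  have "u > 0" "v > 0" using assms(1,2) by (auto simp: x' y' u v intro: gr0I)
  \<comment> \<open>\<open>s\<close> and \<open>t\<close> play the roles of \<open>t\<^sub>1\<close>
    and \<open>t\<^sub>2\<close>.\<close>
  define s t f g where "s = squarefree_part u" and "t = squarefree_part v"
    and "f = square_part u" and "g = square_part v"
  have us: "u = s * f ^ 2" and vt: "v = t * g ^ 2"
    unfolding s_def t_def f_def g_def by (rule squarefree_decompose)+
  have "f > 0" "g > 0" using \<open>u > 0\<close> \<open>v > 0\<close> by (auto simp: us vt intro: gr0I)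
  have cop: "coprime s t" "coprime f g"
    using \<open>coprime u v\<close> by (auto simp: us vt)
  have "squarefree (s * t)"
    using cop(1) by (intro squarefree_mult_coprime) (auto simp: s_def t_def)
  have fg: "h * (s * t) * (f * g) ^ 2 = z ^ 2"
    using huv by (simp add: us vt power_mult_distrib ac_simps)
  \<comment> \<open>Divisibility of squares passes to their bases, so \<open>(f * g) ^ 2\<close> can
    be divided out and \<open>h * (s * t)\<close> is the square of \<open>m\<close>.\<close>
  then have "f * g dvd z" by (metis dvd_triv_right pow_divides_pow_iff zero_less_numeral)
  then obtain m where m: "z = m * (f * g)" by (metis dvd_def mult.commute)
  have "h * (s * t) = m ^ 2"
    using fg \<open>f > 0\<close> \<open>g > 0\<close> by (simp add: m power_mult_distrib)
  then obtain d where d: "h = s * t * d ^ 2"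
    using \<open>squarefree (s * t)\<close> square_mult_squarefreeE by blast
  have "z ^ 2 = (d * s * t * f * g) ^ 2"
    using fg by (simp add: d power2_eq_square ac_simps)
  then have "z = d * s * t * f * g" by (simp only: power2_eq_iff_nonneg zero_le)
  \<comment> \<open>Here \<open>x = h * u ^ 2\<close> with \<open>h = s * t * d ^ 2\<close> and
    \<open>u ^ 2 = s ^ 2 * f ^ 4\<close>; likewise for \<open>y\<close>.\<close>
  moreover have "x = d ^ 2 * s ^ 3 * t * f ^ 4" "y = d ^ 2 * s * t ^ 3 * g ^ 4"
    by (simp_all add: x' y' u v us vt d power_mult_distrib power2_eq_square
        power3_eq_cube power4_eq_xxxx ac_simps)
  ultimately show thesis using cop that by blast
qed

theorem theorem4:
  fixes x y z :: nat
  assumes "x > 0" and "y > 0" and "z > 0"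
  shows "x * y = z ^ 4 \<longleftrightarrow>
    (\<exists>d t\<^sub>1 t\<^sub>2 f g :: nat.
       d > 0 \<and> t\<^sub>1 > 0 \<and> t\<^sub>2 > 0 \<and> f > 0 \<and> g > 0 \<and>
       gcd t\<^sub>1 t\<^sub>2 = 1 \<and> gcd f g = 1 \<and>
       x = d ^ 2 * t\<^sub>1 ^ 3 * t\<^sub>2 * f ^ 4 \<and>
       y = d ^ 2 * t\<^sub>1 * t\<^sub>2 ^ 3 * g ^ 4 \<and>
       z = d * t\<^sub>1 * t\<^sub>2 * f * g)"
    (is "_ \<longleftrightarrow> ?R")
proof
  assume "x * y = z ^ 4"
  then obtain d s t f g where "coprime s t" "coprime f g"
    "x = d ^ 2 * s ^ 3 * t * f ^ 4" "y = d ^ 2 * s * t ^ 3 * g ^ 4" and z: "z = d * s * t * f * g"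
    by (rule mult_eq_power4_param[OF assms(1,2)])
  \<comment> \<open>All five parameters are factors of the positive number \<open>z\<close>.\<close>
  moreover have "d > 0" "s > 0" "t > 0" "f > 0" "g > 0"
    using assms(3) by (simp_all add: z)
  ultimately show ?R
    unfolding coprime_iff_gcd_eq_1
    by (intro exI[of _ d] exI[of _ s] exI[of _ t] exI[of _ f] exI[of _ g] conjI)
next
  assume ?R
  then show "x * y = z ^ 4"
    by (elim exE conjE) (simp add: power_mult_distrib power2_eq_square power3_eq_cube power4_eq_xxxx ac_simps)
qed

end
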